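(* Let $G=(V,E)$ be an undirected graph with $n=|V|\ge 1$ vertices, let $k$ be a positive integer, let $\lambda(k)=\frac{k-1}{k}$, and let $\tau,\rho$ be rational numbers with $0<\tau<\rho<1$ such that either $$\rho \in \left(1 - \frac{4}{(n+1)^2},\; 1 - \frac{1}{(n+1)^2}\right] \quad\text{and}\quad \tau \in \left[(1 - \rho)(n-1),\; \rho - (1 - \sqrt{1-\rho})^2\right),$$ or $$\rho \in \left(1 - \frac{1}{(n+1)^2},\; 1 \right) \quad\text{and}\quad \tau \in \left[(1 - \rho)(n-1),\; (1 - \rho)(n-1) + \frac{1}{n+1}\right).$$ Then the game $\Gamma_{k,\tau,\rho}(G)$ has an evolutionarily stable strategy if and only if $G$ has no clique of size $k$.
   Context: Games and ESS. A finite symmetric two-player game is given by a finite set $S$ of pure strategies and a payoff function $u_1:S\times S\to\mathbb{R}$ of the row player (the column player's payoff is $u_2(i,j)=u_1(j,i)$). A mixed strategy is a probability vector $s$ on $S$, and $U_1(s,t)=\sum_{i,j\in S}s(i)t(j)u_1(i,j)$. A mixed strategy $t$ is a best response to $s$ if $U_1(t,s)=\max_{t'}U_1(t',s)$ over all mixed strategies $t'$. A mixed strategy $s$ is an evolutionarily stable strategy (ESS) if (1) $U_1(s,s)\ge U_1(t,s)$ for every mixed strategy $t$, and (2) for every best response $t\ne s$ to $s$, $U_1(s,t)>U_1(t,t)$. The game. Graphs are finite, undirected and without loops. A clique of $G$ is a set of pairwise adjacent vertices, and its size is its number of vertices. The symmetric game $\Gamma_{k,\tau,\rho}(G)$ has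 pure strategy set $S=V\cup\{a,b,c\}$, where $a,b,c$ are three distinct elements not in $V$, and payoffs: - $u_1(i,j)=\rho$ for $i,j\in V$ with $(i,j)\in E$; - $u_1(i,j)=\tau$ for $i,j\in V$ with $(i,j)\notin E$ (including $i=j$); - $u_1(z,a)=\rho$ for all $z\in S\setminus\{b,c\}$; - $u_1(a,i)=\lambda(k)=\frac{k-1}{k}$ for all $i\in V$; - $u_1(y,i)=\rho$ for $y\in\{b,c\}$, $i\in V$; - $u_1(y,a)=\tau$ for $y\in\{b,c\}$; - $u_1(z,y)=\tau$ for all $z\in S$, $y\in\{b,c\}$. *)

theory Defs
  imports Complex_Main "Graph_Theory.Pair_Digraph"
begin

section \<open>Finite symmetric two-player games\<close>

text \<open>
  Only the payoff of the row player is recorded; the payoff of the column player is its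
  transpose. The payoff function is irrelevant outside of the set of pure strategies.
\<close>

record 's sym_game =
  strategies :: "'s set"
  payoff :: "'s \<Rightarrow> 's \<Rightarrow> real"

text \<open>
  Mixed strategies are required to vanish outside of the set of pure strategies, so that
  equality of mixed strategies is equality of functions.
\<close>

definition mixed :: "('s, 'z) sym_game_scheme \<Rightarrow> ('s \<Rightarrow> real) set" where
  "mixed \<G> = {s. (\<forall>i\<in>strategies \<G>. 0 \<le> s i) \<and> (\<forall>i. i \<notin> strategies \<G> \<longrightarrow> s i = 0) \<and>
     (\<Sum>i\<in>strategies \<G>. s i) = 1}"

definition expected_payoff ::
    "('s, 'z) sym_game_scheme \<Rightarrow> ('s \<Rightarrow> real) \<Rightarrow> ('s \<Rightarrow> real) \<Rightarrow> real" where
  "expected_payoff \<G> s t =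
     (\<Sum>i\<in>strategies \<G>. \<Sum>j\<in>strategies \<G>. s i * t j * payoff \<G> i j)"

definition best_response ::
    "('s, 'z) sym_game_scheme \<Rightarrow> ('s \<Rightarrow> real) \<Rightarrow> ('s \<Rightarrow> real) \<Rightarrow> bool" where
  "best_response \<G> t s \<longleftrightarrow>
     t \<in> mixed \<G> \<and> (\<forall>t'\<in>mixed \<G>. expected_payoff \<G> t' s \<le> expected_payoff \<G> t s)"

definition ess :: "('s, 'z) sym_game_scheme \<Rightarrow> ('s \<Rightarrow> real) \<Rightarrow> bool" where
  "ess \<G> s \<longleftrightarrow> s \<in> mixed \<G> \<and>
     (\<forall>t\<in>mixed \<G>. expected_payoff \<G> s s \<ge> expected_payoff \<G> t s) \<and>
     (\<forall>t. best_response \<G> t s \<and> t \<noteq> s \<longrightarrow> expected_payoff \<G> s t > expected_payoff \<G> t t)"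


section \<open>Cliques\<close>

text \<open>
  Finite undirected loop-free graphs are those satisfying \<^const>\<open>pair_graph\<close>: an undirected
  edge is represented by the two opposite arcs.
\<close>

definition clique :: "'v pair_pre_digraph \<Rightarrow> 'v set \<Rightarrow> bool" where
  "clique G C \<longleftrightarrow> C \<subseteq> pverts G \<and> pairwise (\<lambda>i j. (i, j) \<in> parcs G) C"


section \<open>The game of a graph\<close>

datatype 'v pure = Vertex 'v | A | B | C

definition lam :: "nat \<Rightarrow> real" where
  "lam k = (real k - 1) / real k"

fun graph_payoff ::
    "nat \<Rightarrow> real \<Rightarrow> real \<Rightarrow> 'v pair_pre_digraph \<Rightarrow> 'v pure \<Rightarrow> 'v pure \<Rightarrow> real" where
  "graph_payoff k \<tau> \<rho> G (Vertex i) (Vertex j) = (if (i, j) \<in> parcs G then \<rho> else \<tau>)"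
| "graph_payoff k \<tau> \<rho> G (Vertex i) A = \<rho>"
| "graph_payoff k \<tau> \<rho> G A A = \<rho>"
| "graph_payoff k \<tau> \<rho> G A (Vertex i) = lam k"
| "graph_payoff k \<tau> \<rho> G B (Vertex i) = \<rho>"
| "graph_payoff k \<tau> \<rho> G C (Vertex i) = \<rho>"
| "graph_payoff k \<tau> \<rho> G B A = \<tau>"
| "graph_payoff k \<tau> \<rho> G C A = \<tau>"
| "graph_payoff k \<tau> \<rho> G z B = \<tau>"
| "graph_payoff k \<tau> \<rho> G z C = \<tau>"

definition graph_game ::
    "nat \<Rightarrow> real \<Rightarrow> real \<Rightarrow> 'v pair_pre_digraph \<Rightarrow> 'v pure sym_game" where
  "graph_game k \<tau> \<rho> G =
     \<lparr>strategies = Vertex ` pverts G \<union> {A, B, C}, payoff = graph_payoff k \<tau> \<rho> G\<rparr>"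

end

theory Submission
  imports Defs "HOL-Analysis.Convex"
begin

text \<open>
  If \<open>G\<close> has no clique of size \<open>k\<close>, the pure strategy \<open>a\<close> is an ESS: its best responses are
  supported in \<open>V \<union> {a}\<close>, and against such a strategy putting mass \<open>x\<close> on \<open>V\<close>, distributed as
  \<open>v\<close>, \<open>a\<close> has the advantage \<open>x\<^sup>2 (\<lambda>(k) - U\<^sub>1(v, v))\<close>. This is positive by the
  Motzkin--Straus theorem and the upper bound on \<open>\<tau>\<close>.

  Conversely, let \<open>s\<close> be an ESS. Each pure strategy \<open>z\<close> among \<open>a, b, c\<close> satisfies
  \<open>U\<^sub>1(s, z) = U\<^sub>1(z, z)\<close> once \<open>s\<close> avoids \<open>b\<close> and \<open>c\<close>, so it can be a best response to \<open>s\<close> only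
  if \<open>s = z\<close>. As \<open>b\<close> and \<open>c\<close> are interchangeable and \<open>b\<close> is a best response to every equilibrium
  supported in \<open>V\<close>, this leaves \<open>s = a\<close>, which the uniform strategy on a clique of size \<open>k\<close>
  invades by the lower bound on \<open>\<tau>\<close>.
\<close>

section \<open>The Motzkin--Straus bound\<close>

text \<open>The quadratic form of the adjacency matrix: each undirected edge counts twice. A
  relation with a separate vertex set lets the induction below delete vertices.\<close>

definition edge_form :: "('a \<Rightarrow> 'a \<Rightarrow> bool) \<Rightarrow> 'a set \<Rightarrow> ('a \<Rightarrow> real) \<Rightarrow> real" where
  "edge_form E V v = (\<Sum>i\<in>V. \<Sum>j\<in>V. v i * v j * of_bool (E i j))"

text \<open>Symmetry merges the row and the column of \<open>x\<close>, and irreflexivity removes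
  the diagonal term, so the form is affine in the weight \<open>v x\<close>.\<close>

lemma edge_form_insert:
  assumes "finite V" "x \<notin> V" "symp E" "irreflp E"
  shows "edge_form E (insert x V) v =
    edge_form E V v + 2 * v x * (\<Sum>j\<in>V. v j * of_bool (E x j))"
proof -
  have sym: "E i x = E x i" for i
    using assms(3) by (auto dest: sympD)
  have "\<not> E x x"
    using assms(4) by (auto dest: irreflpD)
  then have "edge_form E (insert x V) v = edge_form E V v +
      (\<Sum>j\<in>V. v x * v j * of_bool (E x j)) + (\<Sum>i\<in>V. v i * v x * of_bool (E i x))"
    using assms(1,2) by (simp add: edge_form_def sum.distrib del: sum_mult_of_bool_eq)
  moreover have "(\<Sum>j\<in>V. v x * v j * of_bool (E x j)) = v x * (\<Sum>j\<in>V. v j * of_bool (E x j))"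
    by (simp only: sum_distrib_left mult.assoc)
  moreover have "(\<Sum>i\<in>V. v i * v x * of_bool (E i x)) = v x * (\<Sum>j\<in>V. v j * of_bool (E x j))"
    by (simp only: sum_distrib_left mult_ac sym)
  ultimately show ?thesis
    by simp
qed

lemma edge_form_cong: "(\<And>i. i \<in> V \<Longrightarrow> v i = v' i) \<Longrightarrow> edge_form E V v = edge_form E V v'"
  by (simp add: edge_form_def)

text \<open>Expanding the squared sum gives all ordered products; only the diagonal ones are missing
  from the form.\<close>

lemma edge_form_complete:
  assumes "finite V" "irreflp E" "pairwise E V"
  shows "edge_form E V v = (\<Sum>i\<in>V. v i)\<^sup>2 - (\<Sum>i\<in>V. (v i)\<^sup>2)"
proof -
  have "(\<Sum>j\<in>V. v i * v j * of_bool (E i j)) = (\<Sum>j\<in>V. v i * v j) - (v i)\<^sup>2"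
    if "i \<in> V" for i
  proof -
    have "(\<Sum>j\<in>V. v i * v j * of_bool (E i j)) =
        (\<Sum>j\<in>V. v i * v j - (if j = i then (v i)\<^sup>2 else 0))"
      using assms(2,3) that
      by (intro sum.cong) (auto simp: pairwise_def irreflp_def power2_eq_square)
    then show ?thesis
      using assms(1) that by (simp add: sum_subtractf)
  qed
  then show ?thesis
    by (simp add: edge_form_def sum_subtractf power2_eq_square sum_product)
qed

text \<open>Induction on the number of vertices: a complete graph is settled by Cauchy-Schwarz, any
  other loses a vertex without decreasing the form. Both sides are homogeneous in \<open>v\<close>,
  so the weights may have any total mass.\<close>

theorem motzkin_straus:
  assumes "finite V" "symp E" "irreflp E"
    and "\<And>i. i \<in> V \<Longrightarrow> 0 \<le> v i"
    and "\<And>K. K \<subseteq> V \<Longrightarrow> pairwise E K \<Longrightarrow> card K \<le> w"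
  shows "edge_form E V v \<le> (1 - 1 / real w) * (\<Sum>i\<in>V. v i)\<^sup>2"
  using assms(1,4,5)
proof (induction "card V" arbitrary: V v)
  case 0
  then show ?case by (simp add: edge_form_def)
next
  case (Suc m)
  show ?case
  proof (cases "pairwise E V")
    case True
    have "1 \<le> card V" "card V \<le> w"
      using Suc.hyps(2) Suc.prems(3)[of V] True by auto
    have "(\<Sum>i\<in>V. v i)\<^sup>2 \<le> (\<Sum>i\<in>V. (v i)\<^sup>2) * real (card V)"
      using sum_squared_le_sum_of_squares[of v V] by simp
    also have "\<dots> \<le> (\<Sum>i\<in>V. (v i)\<^sup>2) * real w"
      using \<open>card V \<le> w\<close> by (intro mult_left_mono) (auto intro: sum_nonneg)
    finally have "(\<Sum>i\<in>V. v i)\<^sup>2 / real w \<le> (\<Sum>i\<in>V. (v i)\<^sup>2)"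
      using \<open>1 \<le> card V\<close> \<open>card V \<le> w\<close> by (simp add: divide_simps)
    then show ?thesis
      using edge_form_complete[OF \<open>finite V\<close> assms(3) True, of v] by (simp add: algebra_simps)
  next
    \<comment> \<open>The form is affine along the direction between two non-adjacent vertices, so all the mass
      of one of them can be moved to the other.\<close>
    case False
    define D where "D U x = (\<Sum>l\<in>U. v l * of_bool (E x l))" for U x
    obtain p q where pq: "p \<in> V" "q \<in> V" "p \<noteq> q" "\<not> E p q"
      using False by (auto simp: pairwise_def)
    \<comment> \<open>Of the two non-adjacent vertices, \<open>i\<close> is one whose neighbourhood
      weighs at least as much; it will receive the mass.\<close>
    obtain i j where ij: "i \<in> V" "j \<in> V" "i \<noteq> j" "\<not> E i j" "\<not> E j i"
      and le: "D (V - {i, j}) j \<le> D (V - {i, j}) i"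
    proof (cases "D (V - {p, q}) q \<le> D (V - {p, q}) p")
      case True
      then show ?thesis using that[of p q] pq assms(2) by (auto dest: sympD)
    next
      case False
      then show ?thesis using that[of q p] pq assms(2) by (auto simp: insert_commute dest: sympD)
    qed
    define U where "U = V - {i, j}"
    have U: "finite U" "i \<notin> U" "j \<notin> U" "V = insert j (insert i U)" "j \<notin> insert i U"
      using ij Suc.prems(1) by (auto simp: U_def)
    define v' where "v' = v(i := v i + v j)"
    have card: "m = card (insert i U)"
      using Suc.hyps(2) U by simp
    have nonneg: "0 \<le> v' l" if "l \<in> insert i U" for l
      using that Suc.prems(2) ij U by (auto simp: v'_def)
    have cliques: "card K \<le> w" if "K \<subseteq> insert i U" "pairwise E K" for K
      using that Suc.prems(3) U(4) by blast
    have v'U: "v' l = v l" if "l \<in> U" for l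
      using that U by (auto simp: v'_def)
    \<comment> \<open>Since \<open>i\<close> and \<open>j\<close> are not adjacent, inserting both
      produces no product of \<open>v i\<close> and \<open>v j\<close>.\<close>
    have "edge_form E V v = edge_form E U v + 2 * v i * D U i + 2 * v j * D U j"
      using U ij assms(2,3) by (simp add: edge_form_insert D_def)
    also have "\<dots> \<le> edge_form E U v + 2 * v i * D U i + 2 * v j * D U i"
      using le Suc.prems(2)[OF \<open>j \<in> V\<close>] by (simp add: U_def mult_left_mono)
    also have "\<dots> = edge_form E (insert i U) v'"
    proof -
      have "(\<Sum>l\<in>U. v' l * of_bool (E i l)) = D U i"
        unfolding D_def by (intro sum.cong) (auto simp: v'U)
      moreover have "edge_form E U v' = edge_form E U v"
        by (rule edge_form_cong) (rule v'U)
      moreover have "v' i = v i + v j" by (simp add: v'_def)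
      ultimately show ?thesis
        using U assms(2,3) by (simp add: edge_form_insert algebra_simps)
    qed
    also have "\<dots> \<le> (1 - 1 / real w) * (\<Sum>l\<in>insert i U. v' l)\<^sup>2"
      using Suc.hyps(1)[OF card] U(1) nonneg cliques by simp
    also have "(\<Sum>l\<in>insert i U. v' l) = (\<Sum>l\<in>V. v l)"
    proof -
      have "(\<Sum>l\<in>U. v' l) = (\<Sum>l\<in>U. v l)" using v'U by simp
      then show ?thesis using U by (simp add: v'_def)
    qed
    finally show ?thesis .
  qed
qed

section \<open>Pure strategies in symmetric games\<close>

definition pure_strategy :: "'s \<Rightarrow> 's \<Rightarrow> real" where
  "pure_strategy z = (\<lambda>i. if i = z then 1 else 0)"

lemma pure_strategy_inject: "pure_strategy y = pure_strategy z \<longleftrightarrow> y = z"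
  by (metis pure_strategy_def zero_neq_one)

lemma pure_strategy_mixed:
  "finite (strategies \<G>) \<Longrightarrow> z \<in> strategies \<G> \<Longrightarrow> pure_strategy z \<in> mixed \<G>"
  by (auto simp: mixed_def pure_strategy_def)

lemma expected_payoff_pure_left:
  assumes "finite (strategies \<G>)" "z \<in> strategies \<G>"
  shows "expected_payoff \<G> (pure_strategy z) t = (\<Sum>j\<in>strategies \<G>. t j * payoff \<G> z j)"
proof -
  have "expected_payoff \<G> (pure_strategy z) t =
      (\<Sum>i\<in>strategies \<G>. if i = z then \<Sum>j\<in>strategies \<G>. t j * payoff \<G> z j else 0)"
    unfolding expected_payoff_def by (intro sum.cong) (auto simp: pure_strategy_def)
  then show ?thesis using assms by simp
qed

lemma expected_payoff_pure_right:
  assumes "finite (strategies \<G>)" "z \<in> strategies \<G>"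
  shows "expected_payoff \<G> t (pure_strategy z) = (\<Sum>i\<in>strategies \<G>. t i * payoff \<G> i z)"
proof -
  have "(\<Sum>j\<in>strategies \<G>. t i * pure_strategy z j * payoff \<G> i j) =
      (\<Sum>j\<in>strategies \<G>. if j = z then t i * payoff \<G> i z else 0)" for i
    by (intro sum.cong) (auto simp: pure_strategy_def)
  then show ?thesis using assms by (simp add: expected_payoff_def)
qed

lemma expected_payoff_pure_pure:
  assumes "finite (strategies \<G>)" "y \<in> strategies \<G>" "z \<in> strategies \<G>"
  shows "expected_payoff \<G> (pure_strategy y) (pure_strategy z) = payoff \<G> y z"
proof -
  have "expected_payoff \<G> (pure_strategy y) (pure_strategy z) =
      (\<Sum>j\<in>strategies \<G>. if j = z then payoff \<G> y z else 0)"
    unfolding expected_payoff_pure_left[OF assms(1,2)]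
    by (intro sum.cong) (auto simp: pure_strategy_def)
  then show ?thesis using assms by simp
qed

lemma expected_payoff_left_average:
  assumes "finite (strategies \<G>)"
  shows "expected_payoff \<G> s t =
    (\<Sum>i\<in>strategies \<G>. s i * expected_payoff \<G> (pure_strategy i) t)"
proof -
  have "s i * expected_payoff \<G> (pure_strategy i) t =
      (\<Sum>j\<in>strategies \<G>. s i * t j * payoff \<G> i j)" if "i \<in> strategies \<G>" for i
    using assms that by (simp add: expected_payoff_pure_left sum_distrib_left mult.assoc)
  then show ?thesis by (simp add: expected_payoff_def)
qed

text \<open>The payoff of \<open>s\<close> is the average of the pure payoffs, none of which exceeds
  it. The weighted deficits are nonnegative with sum zero, so they vanish on the support.\<close>

lemma best_response_support:
  assumes fin: "finite (strategies \<G>)" and s: "s \<in> mixed \<G>"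
    and eq: "\<And>t. t \<in> mixed \<G> \<Longrightarrow> expected_payoff \<G> t s \<le> expected_payoff \<G> s s"
    and z: "z \<in> strategies \<G>" "s z \<noteq> 0"
  shows "best_response \<G> (pure_strategy z) s"
proof -
  let ?S = "strategies \<G>" and ?u = "expected_payoff \<G> s s"
  let ?d = "\<lambda>i. ?u - expected_payoff \<G> (pure_strategy i) s"
  have "(\<Sum>i\<in>?S. s i * ?d i) = (\<Sum>i\<in>?S. s i) * ?u - ?u"
    using expected_payoff_left_average[OF fin, of s s]
    by (simp add: right_diff_distrib sum_subtractf sum_distrib_right)
  also have "\<dots> = 0"
    using s by (simp add: mixed_def)
  finally have "(\<Sum>i\<in>?S. s i * ?d i) = 0" .
  moreover have "0 \<le> s i * ?d i" if "i \<in> ?S" for i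
    using that s eq[OF pure_strategy_mixed[OF fin that]] by (simp add: mixed_def)
  ultimately have "s z * ?d z = 0"
    using fin z(1) sum_nonneg_eq_0_iff[of ?S "\<lambda>i. s i * ?d i"] by blast
  then have "expected_payoff \<G> (pure_strategy z) s = ?u"
    using z by simp
  then show ?thesis
    using eq pure_strategy_mixed[OF fin z(1)] by (simp add: best_response_def)
qed

text \<open>Contrapositive of the second ESS condition; it identifies \<open>s\<close> with any best
  response that \<open>s\<close> does not beat.\<close>

lemma ess_unique_response:
  assumes "ess \<G> s" "best_response \<G> t s" "expected_payoff \<G> s t \<le> expected_payoff \<G> t t"
  shows "s = t"
  using assms by (force simp: ess_def)

section \<open>Evolutionary stability in the game of a graph\<close>

lemma strategies_graph_game: "strategies (graph_game k \<tau> \<rho> G) = Vertex ` pverts G \<union> {A, B, C}"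
  and payoff_graph_game: "payoff (graph_game k \<tau> \<rho> G) = graph_payoff k \<tau> \<rho> G"
  by (simp_all add: graph_game_def)

lemma graph_payoff_B_C:
  "graph_payoff k \<tau> \<rho> G z B = \<tau>" "graph_payoff k \<tau> \<rho> G z C = \<tau>"
  by (cases z; simp)+

section \<open>Payoffs as quadratic forms in the vertex weights\<close>

lemma sum_graph_game:
  assumes "finite (pverts G)"
  shows "(\<Sum>i\<in>strategies (graph_game k \<tau> \<rho> G). f i) =
    (\<Sum>i\<in>pverts G. f (Vertex i)) + f A + f B + f C"
proof -
  have "strategies (graph_game k \<tau> \<rho> G) = insert A (insert B (insert C (Vertex ` pverts G)))"
    by (auto simp: strategies_graph_game)
  moreover have "inj_on Vertex (pverts G)" by (simp add: inj_on_def)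
  moreover have "A \<notin> Vertex ` pverts G" "B \<notin> Vertex ` pverts G" "C \<notin> Vertex ` pverts G" by auto
  ultimately show ?thesis using assms by (simp add: sum.reindex add_ac)
qed

lemma mixed_graph_game_sum:
  assumes "finite (pverts G)" "t \<in> mixed (graph_game k \<tau> \<rho> G)"
  shows "(\<Sum>i\<in>pverts G. t (Vertex i)) + t A + t B + t C = 1"
  using assms(2) sum_graph_game[OF assms(1), where f = t] by (simp add: mixed_def)

lemma mixed_graph_game_nonneg:
  assumes "t \<in> mixed (graph_game k \<tau> \<rho> G)"
  shows "0 \<le> t i"
  using assms by (cases "i \<in> strategies (graph_game k \<tau> \<rho> G)") (auto simp: mixed_def)

text \<open>All pairs of vertices earn the base payoff \<open>\<tau>\<close>, and edges add the
  surplus \<open>\<rho> - \<tau>\<close>.\<close>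

lemma vertex_payoff_edge_form:
  fixes v :: "'v \<Rightarrow> real"
  shows "(\<Sum>i\<in>V. \<Sum>j\<in>V. v i * v j * graph_payoff k \<tau> \<rho> G (Vertex i) (Vertex j)) =
    \<tau> * (\<Sum>i\<in>V. v i)\<^sup>2 + (\<rho> - \<tau>) * edge_form (\<lambda>i j. (i, j) \<in> parcs G) V v"
proof -
  have "v i * v j * graph_payoff k \<tau> \<rho> G (Vertex i) (Vertex j) =
      \<tau> * (v i * v j) + (\<rho> - \<tau>) * (v i * v j * of_bool ((i, j) \<in> parcs G))" for i j
    by (simp add: algebra_simps)
  moreover have "\<tau> * (\<Sum>i\<in>V. v i)\<^sup>2 = (\<Sum>i\<in>V. \<Sum>j\<in>V. \<tau> * (v i * v j))"
    unfolding power2_eq_square sum_product by (simp only: sum_distrib_left)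
  moreover have "(\<rho> - \<tau>) * edge_form E V v =
      (\<Sum>i\<in>V. \<Sum>j\<in>V. (\<rho> - \<tau>) * (v i * v j * of_bool (E i j)))" for E
    by (simp only: edge_form_def sum_distrib_left)
  ultimately show ?thesis
    by (simp only: sum.distrib)
qed

lemma expected_payoff_without_B_C:
  assumes "finite (pverts G)" "t B = 0" "t C = 0" and x: "x = (\<Sum>i\<in>pverts G. t (Vertex i))"
  shows "expected_payoff (graph_game k \<tau> \<rho> G) t t =
    \<tau> * x\<^sup>2 + (\<rho> - \<tau>) * edge_form (\<lambda>i j. (i, j) \<in> parcs G) (pverts G) (t \<circ> Vertex) +
    x * t A * (\<rho> + lam k) + (t A)\<^sup>2 * \<rho>"
proof -
  have "expected_payoff (graph_game k \<tau> \<rho> G) t t =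
    (\<Sum>i\<in>pverts G. \<Sum>j\<in>pverts G.
        (t \<circ> Vertex) i * (t \<circ> Vertex) j * graph_payoff k \<tau> \<rho> G (Vertex i) (Vertex j)) +
    (\<Sum>i\<in>pverts G. t (Vertex i)) * (t A * (\<rho> + lam k)) + (t A)\<^sup>2 * \<rho>"
    using assms(1-3)
    by (simp add: expected_payoff_def sum_graph_game payoff_graph_game sum.distrib
        sum_distrib_left sum_distrib_right power2_eq_square algebra_simps)
  then show ?thesis
    unfolding vertex_payoff_edge_form x by (simp add: comp_def algebra_simps)
qed

lemma edge_form_le_square_sum:
  assumes "\<And>i. i \<in> V \<Longrightarrow> 0 \<le> v i"
  shows "edge_form E V v \<le> (\<Sum>i\<in>V. v i)\<^sup>2"
  unfolding edge_form_def power2_eq_square sum_product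
  using assms by (intro sum_mono) auto

section \<open>Numerical bounds on the payoffs\<close>

text \<open>
  As a function of \<open>w > -1\<close>, \<open>(1 - \<rho>) (w - 1) + 1 / (w + 1)\<close> has its minimum
  \<open>\<rho> - (1 - sqrt (1 - \<rho>))\<^sup>2\<close> at \<open>w + 1 = 1 / sqrt (1 - \<rho>)\<close>, and is decreasing before that point.
\<close>

lemma tau_bound:
  fixes \<rho> \<tau> w n :: real
  assumes "1 \<le> w" "w \<le> n" "\<rho> < 1"
    and "\<tau> < \<rho> - (1 - sqrt (1 - \<rho>))\<^sup>2 \<or>
      1 - 1 / (n + 1)\<^sup>2 < \<rho> \<and> \<tau> < (1 - \<rho>) * (n - 1) + 1 / (n + 1)"
  shows "\<tau> < (1 - \<rho>) * (w - 1) + 1 / (w + 1)"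
  using assms(4)
proof (elim disjE conjE)
  assume \<tau>: "\<tau> < \<rho> - (1 - sqrt (1 - \<rho>))\<^sup>2"
  define q where "q = sqrt (1 - \<rho>)"
  have q: "\<rho> = 1 - q\<^sup>2" using assms(3) by (simp add: q_def)
  have "\<tau> < 2 * q - 2 * q\<^sup>2"
    using \<tau> assms(3) by (simp add: q_def power2_diff)
  \<comment> \<open>The minimum equals \<open>2 * q - 2 * q\<^sup>2\<close>; this square over
    \<open>w + 1\<close> is exactly the excess above it.\<close>
  have "0 \<le> (q * (w + 1) - 1)\<^sup>2 / (w + 1)" using assms(1) by simp
  also have "\<dots> = (q\<^sup>2 * (w - 1) + 1 / (w + 1)) - (2 * q - 2 * q\<^sup>2)"
    using assms(1) by (simp add: field_simps power2_eq_square)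
  finally show ?thesis
    using \<open>\<tau> < 2 * q - 2 * q\<^sup>2\<close> by (simp add: q)
next
  assume \<rho>: "1 - 1 / (n + 1)\<^sup>2 < \<rho>" and \<tau>: "\<tau> < (1 - \<rho>) * (n - 1) + 1 / (n + 1)"
  \<comment> \<open>The assumption on \<open>\<tau>\<close> is the claim at \<open>w = n\<close>.
    Passing from \<open>n\<close> down to \<open>w\<close> lowers the linear term by no more than
    the reciprocal rises.\<close>
  have "(1 - \<rho>) * (n - w) \<le> (1 / (n + 1)\<^sup>2) * (n - w)"
    using assms(2) \<rho> by (intro mult_right_mono) auto
  also have "\<dots> \<le> (1 / ((n + 1) * (w + 1))) * (n - w)"
    using assms(1,2) by (intro mult_right_mono) (auto simp: power2_eq_square intro!: divide_left_mono mult_left_mono)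
  also have "\<dots> = 1 / (w + 1) - 1 / (n + 1)"
    using assms(1,2) by (simp add: field_simps)
  finally show ?thesis using \<tau> by (simp add: algebra_simps)
qed

text \<open>The left side is the Motzkin-Straus bound on self-payoffs over the vertices. The
  hypothesis on \<open>\<tau>\<close> says precisely that it lies below \<open>lam (w + 1)\<close>,
  and \<open>lam\<close> is increasing.\<close>

lemma clique_free_bound:
  fixes w k :: nat and \<tau> \<rho> :: real
  assumes "1 \<le> w" "w < k" "\<tau> < (1 - \<rho>) * (real w - 1) + 1 / (real w + 1)"
  shows "\<tau> + (\<rho> - \<tau>) * (1 - 1 / real w) < lam k"
proof -
  have "\<tau> + (\<rho> - \<tau>) * (1 - 1 / real w) = (\<rho> * (real w - 1) + \<tau>) / real w"
    using assms(1) by (simp add: field_simps)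
  also have "\<dots> < ((real w - 1) + 1 / (real w + 1)) / real w"
    using assms(1,3) by (intro divide_strict_right_mono) (auto simp: algebra_simps)
  also have "\<dots> = 1 - 1 / (real w + 1)"
  proof -
    have "real w + 1 \<noteq> 0" "real w \<noteq> 0" using assms(1) by auto
    then show ?thesis by (simp add: divide_simps) (simp add: algebra_simps)
  qed
  also have "\<dots> \<le> 1 - 1 / real k"
    using assms(2) by (intro diff_left_mono divide_left_mono) auto
  also have "\<dots> = lam k"
    using assms(2) by (simp add: lam_def diff_divide_distrib)
  finally show ?thesis .
qed

section \<open>Stability of the pure strategy \<open>A\<close>\<close>

lemma pair_graph_adjacency:
  assumes "pair_graph G"
  shows "symp (\<lambda>i j. (i, j) \<in> parcs G)" "irreflp (\<lambda>i j. (i, j) \<in> parcs G)" "finite (pverts G)"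
proof -
  interpret pair_graph G by fact
  show "symp (\<lambda>i j. (i, j) \<in> parcs G)" by (auto simp: symp_def intro: arcs_symmetric)
  show "irreflp (\<lambda>i j. (i, j) \<in> parcs G)" by (auto simp: irreflp_def dest: no_loops)
  show "finite (pverts G)" by simp
qed

text \<open>Against \<open>A\<close>, the vertices and \<open>A\<close> itself all earn
  \<open>\<rho>\<close>, while \<open>B\<close> and \<open>C\<close> earn only
  \<open>\<tau>\<close>.\<close>

lemma best_response_A:
  assumes fin: "finite (pverts G)" and "\<tau> < \<rho>"
  shows "best_response (graph_game k \<tau> \<rho> G) t (pure_strategy A) \<longleftrightarrow>
    t \<in> mixed (graph_game k \<tau> \<rho> G) \<and> t B = 0 \<and> t C = 0"
proof -
  let ?\<G> = "graph_game k \<tau> \<rho> G"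
  have finS: "finite (strategies ?\<G>)" and A: "A \<in> strategies ?\<G>"
    using fin by (auto simp: strategies_graph_game)
  have pay: "expected_payoff ?\<G> t (pure_strategy A) = \<rho> - (\<rho> - \<tau>) * (t B + t C)"
    if t: "t \<in> mixed ?\<G>" for t
  proof -
    have "(\<Sum>i\<in>pverts G. t (Vertex i)) = 1 - t A - t B - t C"
      using mixed_graph_game_sum[OF fin t] by simp
    then show ?thesis
      using fin by (simp add: expected_payoff_pure_right[OF finS A] sum_graph_game
          payoff_graph_game flip: sum_distrib_right) (simp add: algebra_simps)
  qed
  have bc: "0 \<le> t B" "0 \<le> t C" if "t \<in> mixed ?\<G>" for t
    using that by (simp_all add: mixed_graph_game_nonneg)
  have A_pay: "expected_payoff ?\<G> (pure_strategy A) (pure_strategy A) = \<rho>"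
    using expected_payoff_pure_pure[OF finS A A] by (simp add: payoff_graph_game)
  show ?thesis
  proof
    assume br: "best_response ?\<G> t (pure_strategy A)"
    then have t: "t \<in> mixed ?\<G>" by (simp add: best_response_def)
    have "\<rho> \<le> expected_payoff ?\<G> t (pure_strategy A)"
      using br A_pay pure_strategy_mixed[OF finS A] by (force simp: best_response_def)
    then have "t B + t C \<le> 0"
      using pay[OF t] \<open>\<tau> < \<rho>\<close> by (simp add: mult_le_0_iff)
    then show "t \<in> mixed ?\<G> \<and> t B = 0 \<and> t C = 0" using bc[OF t] t by auto
  next
    assume "t \<in> mixed ?\<G> \<and> t B = 0 \<and> t C = 0"
    then show "best_response ?\<G> t (pure_strategy A)"
      using pay bc \<open>\<tau> < \<rho>\<close> by (simp add: best_response_def)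
  qed
qed

lemma payoff_A_against_without_B_C:
  assumes "finite (pverts G)" "t B = 0" "t C = 0"
  shows "expected_payoff (graph_game k \<tau> \<rho> G) (pure_strategy A) t =
    (\<Sum>i\<in>pverts G. t (Vertex i)) * lam k + t A * \<rho>"
proof -
  have "finite (strategies (graph_game k \<tau> \<rho> G))" "A \<in> strategies (graph_game k \<tau> \<rho> G)"
    using assms(1) by (auto simp: strategies_graph_game)
  then show ?thesis
    using assms by (simp add: expected_payoff_pure_left sum_graph_game payoff_graph_game
        sum_distrib_right)
qed

text \<open>Substituting \<open>t A = 1 - x\<close> cancels the terms linear in \<open>x\<close>,
  because vertices and \<open>A\<close> earn the same against \<open>A\<close>.\<close>

lemma advantage_A:
  assumes fin: "finite (pverts G)" and t: "t \<in> mixed (graph_game k \<tau> \<rho> G)"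
    and "t B = 0" "t C = 0" and x: "x = (\<Sum>i\<in>pverts G. t (Vertex i))"
  shows "expected_payoff (graph_game k \<tau> \<rho> G) (pure_strategy A) t -
      expected_payoff (graph_game k \<tau> \<rho> G) t t =
    (lam k - \<tau>) * x\<^sup>2 - (\<rho> - \<tau>) * edge_form (\<lambda>i j. (i, j) \<in> parcs G) (pverts G) (t \<circ> Vertex)"
proof -
  have "t A = 1 - x"
    using mixed_graph_game_sum[OF fin t] assms(3,4) x by simp
  show ?thesis
    unfolding expected_payoff_without_B_C[OF fin assms(3,4) x]
      payoff_A_against_without_B_C[OF fin assms(3,4)] x[symmetric] \<open>t A = 1 - x\<close>
    by (simp add: algebra_simps power2_eq_square)
qed

lemma ess_A:
  assumes G: "pair_graph G" and "1 \<le> w" "w < k" "\<tau> < \<rho>"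
    and \<tau>: "\<tau> < (1 - \<rho>) * (real w - 1) + 1 / (real w + 1)"
    and cliques: "\<And>K. clique G K \<Longrightarrow> card K \<le> w"
  shows "ess (graph_game k \<tau> \<rho> G) (pure_strategy A)"
proof -
  let ?\<G> = "graph_game k \<tau> \<rho> G"
  note fin = pair_graph_adjacency(3)[OF G]
  have mixed: "pure_strategy A \<in> mixed ?\<G>"
    using fin by (intro pure_strategy_mixed) (auto simp: strategies_graph_game)
  then have "best_response ?\<G> (pure_strategy A) (pure_strategy A)"
    unfolding best_response_A[OF fin \<open>\<tau> < \<rho>\<close>] by (simp add: pure_strategy_def)
  moreover have "expected_payoff ?\<G> t t < expected_payoff ?\<G> (pure_strategy A) t"
    if br: "best_response ?\<G> t (pure_strategy A)" and neq: "t \<noteq> pure_strategy A" for t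
  proof -
    have t: "t \<in> mixed ?\<G>" "t B = 0" "t C = 0"
      using br best_response_A[OF fin \<open>\<tau> < \<rho>\<close>] by auto
    note nonneg = mixed_graph_game_nonneg[OF t(1)]
    define x where "x = (\<Sum>i\<in>pverts G. t (Vertex i))"
    \<comment> \<open>Strictness below needs mass on the vertices; without any, \<open>t\<close>
      would be \<open>A\<close>.\<close>
    have "x \<noteq> 0"
    proof
      assume "x = 0"
      then have "\<And>i. i \<in> pverts G \<Longrightarrow> t (Vertex i) = 0"
        using fin nonneg by (simp add: x_def sum_nonneg_eq_0_iff)
      moreover have "t (Vertex i) = 0" if "i \<notin> pverts G" for i
        using t(1) that by (auto simp: mixed_def strategies_graph_game)
      moreover have "t A = 1"
        using mixed_graph_game_sum[OF fin t(1)] t \<open>x = 0\<close> by (simp add: x_def)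
      ultimately have "t z = pure_strategy A z" for z
        using t by (cases z) (auto simp: pure_strategy_def)
      with neq show False by blast
    qed
    let ?Q = "edge_form (\<lambda>i j. (i, j) \<in> parcs G) (pverts G) (t \<circ> Vertex)"
    have "?Q \<le> (1 - 1 / real w) * (\<Sum>i\<in>pverts G. (t \<circ> Vertex) i)\<^sup>2"
      by (rule motzkin_straus) (use pair_graph_adjacency[OF G] nonneg cliques in
        \<open>auto simp: clique_def\<close>)
    then have "(\<rho> - \<tau>) * ?Q \<le> (\<rho> - \<tau>) * ((1 - 1 / real w) * x\<^sup>2)"
      using \<open>\<tau> < \<rho>\<close> by (intro mult_left_mono) (auto simp: x_def)
    moreover have "(\<tau> + (\<rho> - \<tau>) * (1 - 1 / real w)) * x\<^sup>2 < lam k * x\<^sup>2"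
      using clique_free_bound[OF assms(2,3) \<tau>] \<open>x \<noteq> 0\<close> by (intro mult_strict_right_mono) auto
    ultimately have "0 < (lam k - \<tau>) * x\<^sup>2 - (\<rho> - \<tau>) * ?Q"
      by (simp add: algebra_simps)
    then show ?thesis
      unfolding advantage_A[OF fin t x_def, symmetric] by simp
  qed
  ultimately show ?thesis
    using mixed unfolding ess_def best_response_def by blast
qed

section \<open>Every ESS is \<open>A\<close>, and a clique of size \<open>k\<close> destroys
  it\<close>

lemma ess_eq_A:
  assumes fin: "finite (pverts G)" and "\<tau> < \<rho>" and ess: "ess (graph_game k \<tau> \<rho> G) s"
  shows "s = pure_strategy A"
proof -
  let ?\<G> = "graph_game k \<tau> \<rho> G"
  have finS: "finite (strategies ?\<G>)" and S: "A \<in> strategies ?\<G>" "B \<in> strategies ?\<G>" "C \<in> strategies ?\<G>"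
    using fin by (auto simp: strategies_graph_game)
  have s: "s \<in> mixed ?\<G>" and opt: "\<And>t. t \<in> mixed ?\<G> \<Longrightarrow> expected_payoff ?\<G> t s \<le> expected_payoff ?\<G> s s"
    using ess by (auto simp: ess_def)
  \<comment> \<open>The columns of \<open>B\<close> and \<open>C\<close> are constant, so no
    strategy does better against them than they do themselves.\<close>
  have bc: "expected_payoff ?\<G> t (pure_strategy y) = \<tau>" if "t \<in> mixed ?\<G>" "y \<in> {B, C}" for t y
  proof -
    have "expected_payoff ?\<G> t (pure_strategy y) = (\<Sum>i\<in>strategies ?\<G>. t i) * \<tau>"
      using that(2) S by (auto simp: expected_payoff_pure_right[OF finS] payoff_graph_game
          graph_payoff_B_C sum_distrib_right)
    then show ?thesis using that(1) by (simp add: mixed_def)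
  qed
  have no_response: "s = pure_strategy y"
    if "best_response ?\<G> (pure_strategy y) s" "y \<in> {B, C}" for y
    using ess_unique_response[OF ess that(1)] that bc s by (simp add: best_response_def)
  \<comment> \<open>Against \<open>B\<close> or \<open>C\<close> everything is a best response, so
    \<open>s\<close> would have to equal both.\<close>
  have not_bc: "s \<noteq> pure_strategy y" if "y \<in> {B, C}" for y
  proof
    assume sy: "s = pure_strategy y"
    have "best_response ?\<G> (pure_strategy z) s" if "z \<in> {B, C}" for z
      using bc[OF _ \<open>y \<in> {B, C}\<close>] pure_strategy_mixed[OF finS] S that
      unfolding sy best_response_def by auto
    then have "s = pure_strategy B" "s = pure_strategy C"
      using no_response by auto
    then show False by (metis pure_strategy_inject pure.distinct(11))
  qed
  have supp: "best_response ?\<G> (pure_strategy z) s" if "z \<in> strategies ?\<G>" "s z \<noteq> 0" for z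
    using best_response_support[OF finS s opt that] by simp
  have s0: "s B = 0" "s C = 0"
    using supp S no_response not_bc by blast+
  \<comment> \<open>An equilibrium on the vertices earns at most \<open>\<rho>\<close>, which
    \<open>B\<close> secures against any vertex; \<open>B\<close> would then be a best
    response.\<close>
  have "s A \<noteq> 0"
  proof
    assume "s A = 0"
    define x where "x = (\<Sum>i\<in>pverts G. s (Vertex i))"
    have x: "x = 1"
      using mixed_graph_game_sum[OF fin s] s0 \<open>s A = 0\<close> by (simp add: x_def)
    have "edge_form (\<lambda>i j. (i, j) \<in> parcs G) (pverts G) (s \<circ> Vertex) \<le> 1"
      using edge_form_le_square_sum[of "pverts G" "s \<circ> Vertex"] x mixed_graph_game_nonneg[OF s]
      by (simp add: x_def)
    then have "(\<rho> - \<tau>) * edge_form (\<lambda>i j. (i, j) \<in> parcs G) (pverts G) (s \<circ> Vertex) \<le> \<rho> - \<tau>"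
      using \<open>\<tau> < \<rho>\<close> by (simp add: mult_left_le)
    then have "expected_payoff ?\<G> s s \<le> \<rho>"
      using expected_payoff_without_B_C[OF fin s0 x_def] \<open>s A = 0\<close> x by simp
    also have "\<rho> = expected_payoff ?\<G> (pure_strategy B) s"
      using fin s0 \<open>s A = 0\<close> x by (simp add: expected_payoff_pure_left[OF finS S(2)] sum_graph_game
          payoff_graph_game x_def flip: sum_distrib_right)
    finally have "best_response ?\<G> (pure_strategy B) s"
      using opt pure_strategy_mixed[OF finS S(2)] by (force simp: best_response_def)
    then show False using no_response not_bc by blast
  qed
  then have "best_response ?\<G> (pure_strategy A) s"
    using supp S by simp
  moreover have "expected_payoff ?\<G> s (pure_strategy A) \<le> expected_payoff ?\<G> (pure_strategy A) (pure_strategy A)"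
  proof -
    have A: "pure_strategy A \<in> mixed ?\<G>" by (rule pure_strategy_mixed[OF finS S(1)])
    then have "best_response ?\<G> (pure_strategy A) (pure_strategy A)"
      unfolding best_response_A[OF fin \<open>\<tau> < \<rho>\<close>] by (simp add: pure_strategy_def)
    then show ?thesis using s by (simp add: best_response_def)
  qed
  ultimately show ?thesis by (rule ess_unique_response[OF ess])
qed

text \<open>The uniform strategy on \<open>K\<close> is a best response to \<open>A\<close>, and the
  lower bound on \<open>\<tau>\<close> makes its self-payoff at least \<open>lam k\<close>, which is
  what \<open>A\<close> earns against it.\<close>

lemma clique_invades_A:
  assumes G: "pair_graph G" and K: "clique G K" "card K = k" and "1 \<le> k" "\<tau> < \<rho>"
    and \<tau>: "(1 - \<rho>) * (real k - 1) \<le> \<tau>"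
  shows "\<not> ess (graph_game k \<tau> \<rho> G) (pure_strategy A)"
proof
  let ?\<G> = "graph_game k \<tau> \<rho> G"
  let ?Q = "edge_form (\<lambda>i j. (i, j) \<in> parcs G)"
  assume ess: "ess ?\<G> (pure_strategy A)"
  note fin = pair_graph_adjacency(3)[OF G]
  define t :: "_ pure \<Rightarrow> real" where
    "t z = (case z of Vertex i \<Rightarrow> of_bool (i \<in> K) / real k | _ \<Rightarrow> 0)" for z
  have KV: "K \<subseteq> pverts G" and pw: "pairwise (\<lambda>i j. (i, j) \<in> parcs G) K"
    using K by (auto simp: clique_def)
  have finK: "finite K" using KV fin finite_subset by blast
  have t0: "t A = 0" "t B = 0" "t C = 0" by (auto simp: t_def)
  have tK: "t (Vertex i) = (if i \<in> K then 1 / real k else 0)" for i by (simp add: t_def)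
  have sum1: "(\<Sum>i\<in>pverts G. t (Vertex i)) = 1"
    using fin KV K(2) \<open>1 \<le> k\<close> by (simp add: tK Int_absorb1 flip: sum.inter_restrict)
  have t: "t \<in> mixed ?\<G>"
    using sum_graph_game[OF fin, where f = t] sum1 t0 KV
    by (auto simp: mixed_def strategies_graph_game tK t_def split: pure.split)
  have br: "best_response ?\<G> t (pure_strategy A)"
    unfolding best_response_A[OF fin \<open>\<tau> < \<rho>\<close>] using t t0 by simp
  have "?Q (pverts G) (t \<circ> Vertex) = ?Q K (t \<circ> Vertex)"
  proof -
    have "(\<Sum>j\<in>pverts G. t (Vertex i) * t (Vertex j) * of_bool ((i, j) \<in> parcs G)) =
        (\<Sum>j\<in>K. t (Vertex i) * t (Vertex j) * of_bool ((i, j) \<in> parcs G))" for i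
      using fin KV by (intro sum.mono_neutral_right) (auto simp: tK)
    moreover have "(\<Sum>i\<in>pverts G. \<Sum>j\<in>K. t (Vertex i) * t (Vertex j) * of_bool ((i, j) \<in> parcs G)) =
        (\<Sum>i\<in>K. \<Sum>j\<in>K. t (Vertex i) * t (Vertex j) * of_bool ((i, j) \<in> parcs G))"
      using fin KV by (intro sum.mono_neutral_right) (auto simp: tK)
    ultimately show ?thesis by (simp add: edge_form_def)
  qed
  also have "\<dots> = 1 - 1 / real k"
    using edge_form_complete[OF finK pair_graph_adjacency(2)[OF G] pw, of "t \<circ> Vertex"] K(2) \<open>1 \<le> k\<close>
    by (simp add: tK power2_eq_square)
  finally have Q: "?Q (pverts G) (t \<circ> Vertex) = 1 - 1 / real k" .
  have "expected_payoff ?\<G> (pure_strategy A) t - expected_payoff ?\<G> t t =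
      (lam k - \<tau>) - (\<rho> - \<tau>) * (1 - 1 / real k)"
    using advantage_A[OF fin t t0(2,3) refl] sum1 Q by simp
  also have "\<dots> = ((1 - \<rho>) * (real k - 1) - \<tau>) / real k"
    using \<open>1 \<le> k\<close> by (simp add: lam_def field_simps)
  also have "\<dots> \<le> 0"
    using \<tau> by (simp add: divide_nonpos_nonneg)
  finally have "pure_strategy A = t"
    using ess_unique_response[OF ess br] by simp
  then have "t A = 1" by (auto simp: pure_strategy_def)
  then show False using t0 by simp
qed

theorem theorem2:
  fixes G :: "'v pair_pre_digraph" and n k :: nat and \<tau> \<rho> :: real
  assumes "pair_graph G"
    and "n = card (pverts G)" and "n \<ge> 1"
    and "k \<ge> 1"
    and "\<tau> \<in> \<rat>" and "\<rho> \<in> \<rat>"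
    and "0 < \<tau>" and "\<tau> < \<rho>" and "\<rho> < 1"
    and "(\<rho> \<in> {1 - 4 / (real n + 1)\<^sup>2 <.. 1 - 1 / (real n + 1)\<^sup>2} \<and>
          \<tau> \<in> {(1 - \<rho>) * (real n - 1) ..< \<rho> - (1 - sqrt (1 - \<rho>))\<^sup>2}) \<or>
         (\<rho> \<in> {1 - 1 / (real n + 1)\<^sup>2 <..< 1} \<and>
          \<tau> \<in> {(1 - \<rho>) * (real n - 1) ..< (1 - \<rho>) * (real n - 1) + 1 / (real n + 1)})"
  shows "(\<exists>s. ess (graph_game k \<tau> \<rho> G) s) \<longleftrightarrow> \<not> (\<exists>K. clique G K \<and> card K = k)"
proof
  assume "\<exists>s. ess (graph_game k \<tau> \<rho> G) s"
  then have ess: "ess (graph_game k \<tau> \<rho> G) (pure_strategy A)"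
    using ess_eq_A[OF pair_graph_adjacency(3)[OF assms(1)] \<open>\<tau> < \<rho>\<close>] by metis
  show "\<not> (\<exists>K. clique G K \<and> card K = k)"
  proof
    assume "\<exists>K. clique G K \<and> card K = k"
    then obtain K where K: "clique G K" "card K = k" by blast
    \<comment> \<open>The lower bound on \<open>\<tau>\<close> is stated for \<open>n\<close>, and
      it carries over to smaller clique sizes.\<close>
    then have "k \<le> n"
      using card_mono[OF pair_graph_adjacency(3)[OF assms(1)]] assms(2) by (auto simp: clique_def)
    then have "(1 - \<rho>) * (real k - 1) \<le> (1 - \<rho>) * (real n - 1)"
      using \<open>\<rho> < 1\<close> by (intro mult_left_mono) auto
    also have "\<dots> \<le> \<tau>" using assms(10) by auto
    finally show False
      using clique_invades_A[OF assms(1) K \<open>1 \<le> k\<close> \<open>\<tau> < \<rho>\<close>] ess by blast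
  qed
next
  assume free: "\<not> (\<exists>K. clique G K \<and> card K = k)"
  note fin = pair_graph_adjacency(3)[OF assms(1)]
  \<comment> \<open>Cliques have at most \<open>n\<close> vertices, and here fewer than
    \<open>k\<close>. The bound by \<open>n\<close> gives the estimate on \<open>\<tau>\<close>, the
    bound by \<open>k - 1\<close> the comparison with \<open>lam k\<close>.\<close>
  define w where "w = min n (k - 1)"
  \<comment> \<open>A single vertex is a clique, which excludes \<open>k = 1\<close> and makes
    \<open>w\<close> positive.\<close>
  obtain v where "v \<in> pverts G" using assms(2,3) by fastforce
  then have "clique G {v}" by (simp add: clique_def)
  then have "k \<noteq> 1" using free by auto
  then have w: "1 \<le> w" "w < k" "w \<le> n" using assms(3,4) by (auto simp: w_def)
  have "card K \<le> w" if "clique G K" for K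
  proof -
    \<comment> \<open>A larger clique would contain one of size exactly \<open>k\<close>.\<close>
    have "card K < k"
    proof (rule ccontr)
      assume "\<not> card K < k"
      then obtain K' where "K' \<subseteq> K" "card K' = k"
        by (meson not_less obtain_subset_with_card_n)
      then show False
        using free \<open>clique G K\<close> pairwise_subset unfolding clique_def by (metis subset_trans)
    qed
    then show ?thesis
      using card_mono[OF fin] that assms(2) by (auto simp: w_def clique_def)
  qed
  moreover have "\<tau> < (1 - \<rho>) * (real w - 1) + 1 / (real w + 1)"
    using w assms(9,10) by (intro tau_bound[of _ "real n"]) auto
  ultimately have "ess (graph_game k \<tau> \<rho> G) (pure_strategy A)"
    using ess_A[OF assms(1) w(1,2) \<open>\<tau> < \<rho>\<close>] by blast
  then show "\<exists>s. ess (graph_game k \<tau> \<rho> G) s" by blast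
qed

end
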